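(* Let $f\in\mathcal{R}$ have Taylor expansion $f(z)=z+\sum_{n=2}^{\infty}a_nz^n$ in $\mathbb{D}$. Then: (i) $|T_2(n)|\le \frac{4}{n^2}+\frac{4}{(n+1)^2}$ for every $n\ge2$; (ii) $|T_3(1)|\le \frac{35}{9}$; (iii) $|T_3(2)|\le \frac{7}{3}$. The inequalities in (i) and (ii) are sharp, i.e. for the inequality in (ii), and for the inequality in (i) for each $n\ge2$, there is a function in $\mathcal{R}$ for which equality holds.
   Context: $\mathbb{D}=\{z\in\mathbb{C}:|z|<1\}$. $\mathcal{A}$ is the class of analytic functions $f$ in $\mathbb{D}$ with Taylor series $f(z)=z+\sum_{n=2}^\infty a_nz^n$. $\mathcal{R}$ is the class of functions $f\in\mathcal{A}$ satisfying $\operatorname{Re} f'(z)>0$ for $z\in\mathbb{D}$. With $a_1=1$, the symmetric Toeplitz determinant $T_q(n)$ of $f$ ($n,q\ge1$) is the determinant of the $q\times q$ matrix whose $(i,j)$ entry is $a_{n+|i-j|}$. Thus $T_2(n)=a_n^2-a_{n+1}^2$, $T_3(1)=\det\begin{pmatrix} 1 & a_2 & a_3 \\ a_2 & 1 & a_2 \\ a_3 & a_2 & 1 \end{pmatrix}$ and $T_3(2)=\det\begin{pmatrix} a_2 & a_3 & a_4 \\ a_3 & a_2 & a_3 \\ a_4 & a_3 & a_2 \end{pmatrix}$. *)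

theory Defs
  imports "HOL-Complex_Analysis.Complex_Analysis" "Jordan_Normal_Form.Determinant"
begin

abbreviation unit_disc :: "complex set" ("\<D>")
  where "\<D> \<equiv> ball 0 1"

definition taylor_coeff :: "(complex \<Rightarrow> complex) \<Rightarrow> nat \<Rightarrow> complex"
  where "taylor_coeff f n = (deriv ^^ n) f 0 / fact n"

definition class_A :: "(complex \<Rightarrow> complex) set"
  where "class_A = {f. f analytic_on \<D> \<and> taylor_coeff f 0 = 0 \<and> taylor_coeff f 1 = 1}"

definition class_R :: "(complex \<Rightarrow> complex) set"
  where "class_R = {f \<in> class_A. \<forall>z\<in>\<D>. Re (deriv f z) > 0}"

text \<open>
  The indices \<open>i\<close>, \<open>j\<close> run over \<open>{0..<q}\<close>; only their distance enters.
  Qualified names select the matrices whose dimension is a natural number,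
  rather than those indexed by a finite type.
\<close>

definition toeplitz_det :: "(complex \<Rightarrow> complex) \<Rightarrow> nat \<Rightarrow> nat \<Rightarrow> complex"
  where "toeplitz_det f q n =
    Determinant.det (Matrix.mat q q (\<lambda>(i, j). taylor_coeff f (n + nat \<bar>int i - int j\<bar>)))"

lemma class_A_taylor_series:
  assumes "f \<in> class_A" and "z \<in> \<D>"
  shows "(\<lambda>n. taylor_coeff f (n + 2) * z ^ (n + 2)) sums (f z - z)"
proof -
  have "f holomorphic_on \<D>"
    using assms by (auto simp: class_A_def intro: analytic_imp_holomorphic)
  then have "(\<lambda>n. taylor_coeff f n * z ^ n) sums f z"
    using holomorphic_power_series[of f 0 1 z] assms(2) by (simp add: taylor_coeff_def)
  then show ?thesis
    using assms(1) sums_iff_shift[of "\<lambda>n. taylor_coeff f n * z ^ n" 2 "f z - z"]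
    by (simp add: class_A_def numeral_2_eq_2)
qed

lemma det_mat_2:
  fixes A :: "'a :: comm_ring_1 mat"
  assumes "A \<in> carrier_mat 2 2"
  shows "Determinant.det A = A $$ (0, 0) * A $$ (1, 1) - A $$ (0, 1) * A $$ (1, 0)"
proof -
  have del: "Determinant.det (mat_delete A i 0) = A $$ (1 - i, 1)" if "i < 2" for i
  proof -
    have "Determinant.det (mat_delete A i 0) = mat_delete A i 0 $$ (0, 0)"
      using assms by (intro det_single) (auto simp: mat_delete_def)
    also have "\<dots> = A $$ (1 - i, 1)"
      using assms that by (auto simp: mat_delete_def less_2_cases_iff)
    finally show ?thesis .
  qed
  have "Determinant.det A = (\<Sum>i<2. A $$ (i, 0) * cofactor A i 0)"
    using assms by (intro laplace_expansion_column) auto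
  then show ?thesis
    by (simp add: cofactor_def del numeral_2_eq_2 algebra_simps)
qed

lemma toeplitz_det_2:
  "toeplitz_det f 2 n = taylor_coeff f n ^ 2 - taylor_coeff f (n + 1) ^ 2"
  unfolding toeplitz_det_def
  by (subst det_mat_2[OF mat_carrier]) (simp add: power2_eq_square)

lemma toeplitz_det_3:
  fixes f n
  defines "a \<equiv> taylor_coeff f"
  shows "toeplitz_det f 3 n = a n ^ 3 + 2 * a (n + 1) ^ 2 * a (n + 2)
           - 2 * a n * a (n + 1) ^ 2 - a n * a (n + 2) ^ 2"
proof -
  let ?M = "Matrix.mat 3 3 (\<lambda>(i, j). a (n + nat \<bar>int i - int j\<bar>))"
  have del: "Determinant.det (mat_delete ?M i 0) =
      mat_delete ?M i 0 $$ (0, 0) * mat_delete ?M i 0 $$ (1, 1) -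
      mat_delete ?M i 0 $$ (0, 1) * mat_delete ?M i 0 $$ (1, 0)" for i
    by (rule det_mat_2) (simp add: mat_delete_def carrier_matI)
  have "Determinant.det ?M = (\<Sum>i<3. ?M $$ (i, 0) * cofactor ?M i 0)"
    by (rule laplace_expansion_column) auto
  also have "\<dots> = a n ^ 3 + 2 * a (n + 1) ^ 2 * a (n + 2)
           - 2 * a n * a (n + 1) ^ 2 - a n * a (n + 2) ^ 2"
    unfolding cofactor_def del
    by (simp add: mat_delete_def eval_nat_numeral algebra_simps)
  finally show ?thesis unfolding toeplitz_det_def a_def .
qed

end

theory Submission
  imports Defs
begin

text \<open>
  Let \<open>p = f' = 1 + \<Sum> 2 e\<^sub>k z\<^sup>k\<close>, so that \<open>n a\<^sub>n = 2 e\<^sub>n\<^sub>-\<^sub>1\<close>. For \<open>r < 1\<close> the function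
  \<open>t \<mapsto> Re p(r exp(2\<pi>it))\<close> is a probability density on \<open>[0,1]\<close>, and \<open>e\<^sub>k r\<^sup>k\<close> is the expectation
  of \<open>u\<^sup>k\<close> for the unimodular variable \<open>u = exp(-2\<pi>it)\<close>. With \<open>m = E u\<close>, the variance of \<open>u\<close> is
  \<open>1 - |m|\<^sup>2\<close>; it bounds both \<open>E u\<^sup>2 - m\<^sup>2 = E (u - m)\<^sup>2\<close> and, by AM-GM,
  \<open>m (E u\<^sup>3 - m E u\<^sup>2) = E (m (u - m) u\<^sup>2)\<close>. Letting \<open>r\<close> tend to \<open>1\<close> gives inequalities for
  \<open>e\<^sub>1, e\<^sub>2, e\<^sub>3\<close> from which the determinant bounds follow by the factorisations
  \<open>T\<^sub>3(1) = 1 - 2a\<^sub>2\<^sup>2 + a\<^sub>3(2a\<^sub>2\<^sup>2 - a\<^sub>3)\<close> and \<open>T\<^sub>3(2) = (a\<^sub>2 - a\<^sub>4)(a\<^sub>2\<^sup>2 - 2a\<^sub>3\<^sup>2 + a\<^sub>2a\<^sub>4)\<close>.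
  Equality in both sharp cases is attained for \<open>f'(z) = (1 + iz)/(1 - iz)\<close>.
\<close>

section \<open>Moments of a unimodular variable under a probability density\<close>

lemma has_integral_norm_le:
  fixes f :: "'a::euclidean_space \<Rightarrow> 'b::banach"
  assumes "(f has_integral i) S" "(g has_integral j) S" "\<And>x. x \<in> S \<Longrightarrow> norm (f x) \<le> g x"
  shows "norm i \<le> j"
proof -
  have "norm (integral S f) \<le> integral S g"
    using assms by (intro integral_norm_bound_integral) auto
  then show ?thesis
    using assms(1,2) by (simp add: integral_unique)
qed

context
  fixes S :: "real set" and w :: "real \<Rightarrow> real" and u :: "real \<Rightarrow> complex" and e :: "nat \<Rightarrow> complex"
  assumes moment: "\<And>k. ((\<lambda>t. of_real (w t) * u t ^ k) has_integral e k) S"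
    and mass: "e 0 = 1"
    and nonneg: "\<And>t. t \<in> S \<Longrightarrow> 0 \<le> w t"
    and unimodular: "\<And>t. t \<in> S \<Longrightarrow> cmod (u t) = 1"
begin

lemma weight_has_integral: "(w has_integral 1) S"
  using has_integral_Re[OF moment[of 0]] mass by simp

lemma norm_moment_le: "cmod (e k) \<le> 1"
  by (rule has_integral_norm_le[OF moment weight_has_integral])
     (simp add: norm_mult norm_power nonneg unimodular)

text \<open>Since \<open>u t\<close> is unimodular, the squared distance to the mean is an affine
  function of the real part of \<open>cnj (e 1) * u t\<close>, so the total mass and the first
  moment already determine its integral.\<close>

lemma variance_has_integral:
  "((\<lambda>t. w t * (cmod (u t - e 1))\<^sup>2) has_integral (1 - (cmod (e 1))\<^sup>2)) S"
proof -
  have int: "((\<lambda>t. w t * (1 + (cmod (e 1))\<^sup>2) - 2 * Re (cnj (e 1) * (of_real (w t) * u t ^ 1)))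
      has_integral (1 * (1 + (cmod (e 1))\<^sup>2) - 2 * Re (cnj (e 1) * e 1))) S"
    by (intro has_integral_diff has_integral_mult_left has_integral_mult_right
        weight_has_integral has_integral_Re moment)
  have val: "1 * (1 + (cmod (e 1))\<^sup>2) - 2 * Re (cnj (e 1) * e 1) = 1 - (cmod (e 1))\<^sup>2"
    by (simp add: cmod_power2 flip: power2_eq_square)
  have eq: "w t * (1 + (cmod (e 1))\<^sup>2) - 2 * Re (cnj (e 1) * (of_real (w t) * u t ^ 1))
      = w t * (cmod (u t - e 1))\<^sup>2" if "t \<in> S" for t
  proof -
    have "(Re (u t))\<^sup>2 + (Im (u t))\<^sup>2 = 1"
      using unimodular[OF that] by (metis cmod_power2 one_power2)
    then have "(cmod (u t - e 1))\<^sup>2 = 1 + (cmod (e 1))\<^sup>2 - 2 * Re (cnj (e 1) * u t)"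
      by (simp add: cmod_power2 power2_diff)
    moreover have "Re (cnj (e 1) * (of_real (w t) * u t ^ 1)) = w t * Re (cnj (e 1) * u t)"
      by (simp add: algebra_simps)
    ultimately show ?thesis
      by (simp only: right_diff_distrib mult.left_commute[of 2])
  qed
  show ?thesis
    by (rule has_integral_eq[OF eq int[unfolded val]])
qed

lemma norm_second_moment_diff_le: "cmod (e 2 - (e 1)\<^sup>2) \<le> 1 - (cmod (e 1))\<^sup>2"
proof (rule has_integral_norm_le[OF _ variance_has_integral])
  have "((\<lambda>t. of_real (w t) * u t ^ 2 - 2 * e 1 * (of_real (w t) * u t ^ 1)
      + (e 1)\<^sup>2 * (of_real (w t) * u t ^ 0)) has_integral (e 2 - 2 * e 1 * e 1 + (e 1)\<^sup>2 * e 0)) S"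
    by (intro has_integral_diff has_integral_add has_integral_mult_right moment)
  then show "((\<lambda>t. of_real (w t) * (u t - e 1)\<^sup>2) has_integral (e 2 - (e 1)\<^sup>2)) S"
    by (simp add: mass power2_eq_square algebra_simps)
qed (simp add: norm_mult norm_power nonneg)

lemma norm_third_moment_diff_le:
  "cmod (e 1 * (e 3 - e 1 * e 2)) \<le> (cmod (e 1))\<^sup>2 / 3 + 3 / 4 * (1 - (cmod (e 1))\<^sup>2)"
proof (rule has_integral_norm_le)
  show "((\<lambda>t. e 1 * (of_real (w t) * u t ^ 3 - e 1 * (of_real (w t) * u t ^ 2)))
      has_integral e 1 * (e 3 - e 1 * e 2)) S"
    by (intro has_integral_diff has_integral_mult_right moment)
  show "((\<lambda>t. w t * ((cmod (e 1))\<^sup>2 / 3) + 3 / 4 * (w t * (cmod (u t - e 1))\<^sup>2))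
      has_integral (cmod (e 1))\<^sup>2 / 3 + 3 / 4 * (1 - (cmod (e 1))\<^sup>2)) S"
    using has_integral_add[OF has_integral_mult_left[OF weight_has_integral]
        has_integral_mult_right[OF variance_has_integral]]
    by (simp only: mult_1)
next
  fix t assume t: "t \<in> S"
  have eq: "e 1 * (of_real (w t) * u t ^ 3 - e 1 * (of_real (w t) * u t ^ 2))
      = of_real (w t) * (e 1 * (u t - e 1) * u t ^ 2)"
    by (simp add: algebra_simps power2_eq_square power3_eq_cube)
  have "cmod (e 1 * (of_real (w t) * u t ^ 3 - e 1 * (of_real (w t) * u t ^ 2)))
      = w t * (cmod (e 1) * cmod (u t - e 1))"
    unfolding eq using t by (simp add: norm_mult norm_power nonneg unimodular)
  also have "\<dots> \<le> w t * ((cmod (e 1))\<^sup>2 / 3 + 3 / 4 * (cmod (u t - e 1))\<^sup>2)"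
  proof (rule mult_left_mono[OF _ nonneg[OF t]])
    \<comment> \<open>Weighted AM-GM: dividing the expanded square by 12 gives the weights 1/3 and
      3/4. The weight 1/3 is what later yields exactly 14/9 at \<open>cmod (e 1) = 1\<close> in the
      bound for \<open>toeplitz_det f 3 2\<close>.\<close>
    have "0 \<le> (2 * cmod (e 1) - 3 * cmod (u t - e 1))\<^sup>2"
      by simp
    then show "cmod (e 1) * cmod (u t - e 1) \<le> (cmod (e 1))\<^sup>2 / 3 + 3 / 4 * (cmod (u t - e 1))\<^sup>2"
      by (simp add: power2_diff power_mult_distrib)
  qed
  finally show "cmod (e 1 * (of_real (w t) * u t ^ 3 - e 1 * (of_real (w t) * u t ^ 2)))
      \<le> w t * ((cmod (e 1))\<^sup>2 / 3) + 3 / 4 * (w t * (cmod (u t - e 1))\<^sup>2)"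
    by (simp add: algebra_simps)
qed

end

section \<open>Taylor coefficients as integrals over circles\<close>

lemma taylor_coeff_has_integral:
  assumes "p holomorphic_on \<D>" "0 < r" "r < 1"
  shows "((\<lambda>t. p (circlepath 0 r t) * exp (- (2 * of_real pi * \<i> * of_real t)) ^ k)
    has_integral taylor_coeff p k * of_real r ^ k) {0..1}"
proof -
  have "cball 0 r \<subseteq> \<D>"
    using assms by auto
  then have "continuous_on (cball 0 r) p" "p holomorphic_on ball 0 r"
    using assms(1) by (meson ball_subset_cball holomorphic_on_imp_continuous_on holomorphic_on_subset)+
  then have "((\<lambda>z. p z / (z - 0) ^ Suc k) has_contour_integral
      2 * pi * \<i> / fact k * (deriv ^^ k) p 0) (circlepath 0 r)"
    using assms by (intro Cauchy_has_contour_integral_higher_derivative_circlepath) auto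
  then have "((\<lambda>t. of_real r ^ k / (2 * pi * \<i>) * (p (circlepath 0 r t) / (circlepath 0 r t - 0) ^ Suc k
        * vector_derivative (circlepath 0 r) (at t)))
      has_integral of_real r ^ k / (2 * pi * \<i>) * (2 * pi * \<i> / fact k * (deriv ^^ k) p 0)) {0..1}"
    unfolding has_contour_integral by (rule has_integral_mult_right)
  \<comment> \<open>On the circle dz = 2 pi i z dt, which cancels one power of z, and (r / z)^k is
    the k-th power of exp(-2 pi i t).\<close>
  moreover have "of_real r ^ k / (2 * pi * \<i>) * (p (circlepath 0 r t) / (circlepath 0 r t - 0) ^ Suc k
        * vector_derivative (circlepath 0 r) (at t))
      = p (circlepath 0 r t) * exp (- (2 * of_real pi * \<i> * of_real t)) ^ k" for t
    unfolding vector_derivative_circlepath unfolding circlepath using assms(2)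
    by (simp add: exp_minus power_mult_distrib field_simps)
  moreover have "of_real r ^ k / (2 * pi * \<i>) * (2 * pi * \<i> / fact k * (deriv ^^ k) p 0)
      = taylor_coeff p k * of_real r ^ k"
    by (simp add: taylor_coeff_def field_simps)
  ultimately show ?thesis
    by simp
qed

text \<open>Write Re p as half the sum of p and its conjugate. The summand p contributes the Taylor
  coefficient by Cauchy's formula. The conjugate contributes the conjugated mean of p(z) z^k over
  the circle, divided by r^k; this mean is the value at the centre, namely
  \<open>0 ^ k\<close>.\<close>

lemma Re_has_integral_moment:
  assumes "p holomorphic_on \<D>" "p 0 = 1" "0 < r" "r < 1"
  shows "((\<lambda>t. of_real (Re (p (circlepath 0 r t))) * exp (- (2 * of_real pi * \<i> * of_real t)) ^ k)
    has_integral (taylor_coeff p k * of_real r ^ k + 0 ^ k) / 2) {0..1}"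
proof -
  let ?u = "\<lambda>t. exp (- (2 * of_real pi * \<i> * complex_of_real t))"
  have "((\<lambda>t. (p (circlepath 0 r t) * circlepath 0 r t ^ k) * ?u t ^ 0)
      has_integral taylor_coeff (\<lambda>z. p z * z ^ k) 0 * of_real r ^ 0) {0..1}"
    using assms by (intro taylor_coeff_has_integral holomorphic_intros)
  then have "((\<lambda>t. p (circlepath 0 r t) * circlepath 0 r t ^ k) has_integral 0 ^ k) {0..1}"
    using assms(2) by (simp add: taylor_coeff_def)
  then have "((\<lambda>t. p (circlepath 0 r t) * circlepath 0 r t ^ k / of_real r ^ k)
      has_integral 0 ^ k / of_real r ^ k) {0..1}"
    by (rule has_integral_divide)
  moreover have "cnj (p (circlepath 0 r t) * circlepath 0 r t ^ k / of_real r ^ k)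
      = cnj (p (circlepath 0 r t)) * ?u t ^ k" for t
    using assms(3) by (simp add: circlepath power_mult_distrib exp_cnj)
  ultimately have "((\<lambda>t. cnj (p (circlepath 0 r t)) * ?u t ^ k)
      has_integral cnj (0 ^ k / of_real r ^ k)) {0..1}"
    using has_integral_cnj[of "\<lambda>t. p (circlepath 0 r t) * circlepath 0 r t ^ k / of_real r ^ k"]
    by (simp only: o_def)
  then have "((\<lambda>t. cnj (p (circlepath 0 r t)) * ?u t ^ k) has_integral 0 ^ k) {0..1}"
    by (cases k) auto
  from has_integral_divide[OF has_integral_add[OF taylor_coeff_has_integral[OF assms(1,3,4), of k] this], of 2]
  show ?thesis
    by (simp add: distrib_right[symmetric] complex_add_cnj)
qed

section \<open>Passage to radius 1 and coefficient bounds for positive real part\<close>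

lemma le_of_le_on_open_interval:
  fixes g h :: "real \<Rightarrow> real"
  assumes "continuous_on UNIV g" "continuous_on UNIV h" "\<And>r. 0 < r \<Longrightarrow> r < 1 \<Longrightarrow> g r \<le> h r"
  shows "g 1 \<le> h 1"
proof (rule tendsto_le[of "at_left 1" h _ g])
  show "(h \<longlongrightarrow> h 1) (at_left 1)" "(g \<longlongrightarrow> g 1) (at_left 1)"
    using assms by (auto simp: continuous_on_def intro: tendsto_within_subset)
  show "\<forall>\<^sub>F r in at_left 1. g r \<le> h r"
    by (rule eventually_mono[OF eventually_at_left_real[of 0]]) (use assms(3) in auto)
qed simp

context
  fixes p :: "complex \<Rightarrow> complex"
  assumes hol: "p holomorphic_on \<D>" and one: "p 0 = 1" and pos: "\<And>z. z \<in> \<D> \<Longrightarrow> 0 < Re (p z)"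
begin

text \<open>The \<open>k\<close>-th moment at radius \<open>r\<close>. Being a polynomial in
  \<open>r\<close>, it keeps a meaning at \<open>r = 1\<close>, where the circle leaves the open
  disc. The summand \<open>0 ^ k\<close> makes the zeroth moment equal to 1.\<close>

private definition half_coeff :: "nat \<Rightarrow> real \<Rightarrow> complex"
  where "half_coeff k r = (taylor_coeff p k * of_real r ^ k + 0 ^ k) / 2"

private lemma continuous_half_coeff [continuous_intros]: "continuous_on A (half_coeff k)"
  unfolding half_coeff_def by (intro continuous_intros) auto

private lemma half_coeff_1: "0 < k \<Longrightarrow> half_coeff k 1 = taylor_coeff p k / 2"
  by (simp add: half_coeff_def)

text \<open>The conclusions are listed in the order of the assumptions on \<open>S\<close>,
  \<open>w\<close>, \<open>u\<close> and \<open>e\<close> in the moment inequalities, so that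
  \<open>OF\<close> discharges all of them at once.\<close>

private lemma half_coeff_moments:
  assumes "0 < r" "r < 1"
  shows "((\<lambda>t. of_real (Re (p (circlepath 0 r t))) * exp (- (2 * of_real pi * \<i> * of_real t)) ^ k)
      has_integral half_coeff k r) {0..1}"
    and "half_coeff 0 r = 1"
    and "0 \<le> Re (p (circlepath 0 r t))"
    and "cmod (exp (- (2 * of_real pi * \<i> * complex_of_real t))) = 1"
proof -
  have "circlepath 0 r t \<in> \<D>"
    using assms by (simp add: circlepath norm_mult)
  then show "0 \<le> Re (p (circlepath 0 r t))"
    by (rule less_imp_le[OF pos])
qed (use Re_has_integral_moment[OF hol one assms] one
    in \<open>simp_all add: half_coeff_def taylor_coeff_def norm_exp_eq_Re\<close>)

lemma Caratheodory_coeff_le: "0 < k \<Longrightarrow> cmod (taylor_coeff p k) \<le> 2"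
  using le_of_le_on_open_interval[of "\<lambda>r. cmod (half_coeff k r)" "\<lambda>_. 1"]
    norm_moment_le[OF half_coeff_moments]
  by (simp add: continuous_intros half_coeff_1 norm_divide)

lemma Caratheodory_coeff_2_le:
  "cmod (taylor_coeff p 2 / 2 - (taylor_coeff p 1 / 2)\<^sup>2) \<le> 1 - (cmod (taylor_coeff p 1 / 2))\<^sup>2"
  using le_of_le_on_open_interval[of "\<lambda>r. cmod (half_coeff 2 r - (half_coeff 1 r)\<^sup>2)"
      "\<lambda>r. 1 - (cmod (half_coeff 1 r))\<^sup>2"]
    norm_second_moment_diff_le[OF half_coeff_moments]
  by (simp add: continuous_intros half_coeff_1)

lemma Caratheodory_coeff_3_le:
  defines "e \<equiv> \<lambda>k. taylor_coeff p k / 2"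
  shows "cmod (e 1 * (e 3 - e 1 * e 2)) \<le> (cmod (e 1))\<^sup>2 / 3 + 3 / 4 * (1 - (cmod (e 1))\<^sup>2)"
  using le_of_le_on_open_interval[of
      "\<lambda>r. cmod (half_coeff 1 r * (half_coeff 3 r - half_coeff 1 r * half_coeff 2 r))"
      "\<lambda>r. (cmod (half_coeff 1 r))\<^sup>2 / 3 + 3 / 4 * (1 - (cmod (half_coeff 1 r))\<^sup>2)"]
    norm_third_moment_diff_le[OF half_coeff_moments]
  by (simp add: continuous_intros half_coeff_1 e_def)

end

section \<open>Determinant bounds on \<open>class_R\<close>\<close>

lemma taylor_coeff_Suc: "taylor_coeff f (Suc n) = taylor_coeff (deriv f) n / of_nat (Suc n)"
  unfolding taylor_coeff_def by (simp add: funpow_Suc_right del: funpow.simps)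

context
  fixes f assumes f: "f \<in> class_R"
begin

text \<open>For positive \<open>k\<close> this is the limit of the moments as the radius tends to 1;
  at \<open>k = 0\<close> it is 1/2, not the total mass 1.\<close>

private definition e :: "nat \<Rightarrow> complex"
  where "e k = taylor_coeff (deriv f) k / 2"

private lemma deriv_class_R:
  shows "deriv f holomorphic_on \<D>" "deriv f 0 = 1" "\<And>z. z \<in> \<D> \<Longrightarrow> 0 < Re (deriv f z)"
proof -
  have "f holomorphic_on \<D>"
    using f by (simp add: class_R_def class_A_def analytic_imp_holomorphic)
  then show "deriv f holomorphic_on \<D>"
    by (rule holomorphic_deriv) simp
qed (use f in \<open>simp_all add: class_R_def class_A_def taylor_coeff_def\<close>)

private lemma taylor_coeff_eq: "0 < n \<Longrightarrow> taylor_coeff f n = 2 * e (n - 1) / of_nat n"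
  using taylor_coeff_Suc[of f "n - 1"] by (simp add: e_def)

private lemma e_le: "0 < k \<Longrightarrow> cmod (e k) \<le> 1"
  using Caratheodory_coeff_le[OF deriv_class_R] by (simp add: e_def norm_divide)

lemma class_R_coeff_le:
  assumes "2 \<le> n"
  shows "cmod (taylor_coeff f n) \<le> 2 / real n"
  using assms e_le[of "n - 1"]
  by (simp add: taylor_coeff_eq norm_divide norm_mult divide_right_mono)

lemma toeplitz_det_2_le:
  assumes "2 \<le> n"
  shows "cmod (toeplitz_det f 2 n) \<le> 4 / real n ^ 2 + 4 / (real n + 1) ^ 2"
proof -
  have "cmod (toeplitz_det f 2 n) \<le> cmod (taylor_coeff f n) ^ 2 + cmod (taylor_coeff f (n + 1)) ^ 2"
    unfolding toeplitz_det_2 by (metis norm_triangle_ineq4 norm_power)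
  also have "\<dots> \<le> (2 / real n) ^ 2 + (2 / real (n + 1)) ^ 2"
    using assms by (intro add_mono power_mono class_R_coeff_le) auto
  finally show ?thesis
    by (simp add: power_divide add.commute)
qed

private lemma low_coeffs:
  "taylor_coeff f 1 = 1" "taylor_coeff f 2 = e 1" "taylor_coeff f 3 = 2 / 3 * e 2"
  "taylor_coeff f 4 = e 3 / 2"
  using taylor_coeff_eq[of 2] taylor_coeff_eq[of 3] taylor_coeff_eq[of 4] f
  by (simp_all add: class_R_def class_A_def)

private lemma e_2_diff_le: "cmod (e 2 - (e 1)\<^sup>2) \<le> 1 - (cmod (e 1))\<^sup>2"
  using Caratheodory_coeff_2_le[OF deriv_class_R] by (simp add: e_def)

private lemma e_1_sq_le: "(cmod (e 1))\<^sup>2 \<le> 1"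
  using e_le[of 1] by (simp add: power_le_one)

lemma toeplitz_det_3_1_le: "cmod (toeplitz_det f 3 1) \<le> 35 / 9"
proof -
  \<comment> \<open>This is 2 a_2^2 - a_3, split so that the variance bound applies: 4/3 t + 2/3 (1
    - t) with t = |e_1|^2 is at most 4/3, whereas the direct triangle inequality would give
    8/3.\<close>
  have "cmod (4 / 3 * (e 1)\<^sup>2 - 2 / 3 * (e 2 - (e 1)\<^sup>2))
      \<le> 4 / 3 * (cmod (e 1))\<^sup>2 + 2 / 3 * cmod (e 2 - (e 1)\<^sup>2)"
    by (rule order.trans[OF norm_triangle_ineq4])
      (simp add: norm_mult norm_power norm_divide del: right_diff_distrib_numeral)
  also have "\<dots> \<le> 4 / 3"
    using e_2_diff_le e_1_sq_le by simp
  finally have "cmod (e 2) * cmod (4 / 3 * (e 1)\<^sup>2 - 2 / 3 * (e 2 - (e 1)\<^sup>2)) \<le> 1 * (4 / 3)"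
    using e_le[of 2] by (intro mult_mono) auto
  then have bound: "cmod (2 / 3 * e 2 * (4 / 3 * (e 1)\<^sup>2 - 2 / 3 * (e 2 - (e 1)\<^sup>2))) \<le> 8 / 9"
    by (simp add: norm_mult)
  have "cmod (1 - 2 * (e 1)\<^sup>2) \<le> 1 + 2 * (cmod (e 1))\<^sup>2"
    by (rule order.trans[OF norm_triangle_ineq4]) (simp add: norm_mult norm_power)
  then have three: "cmod (1 - 2 * (e 1)\<^sup>2) \<le> 3"
    using e_1_sq_le by simp
  have sums: "1 + 1 = (2::nat)" "1 + 2 = (3::nat)"
    by simp_all
  have eq: "toeplitz_det f 3 1 = (1 - 2 * (e 1)\<^sup>2)
      + 2 / 3 * e 2 * (4 / 3 * (e 1)\<^sup>2 - 2 / 3 * (e 2 - (e 1)\<^sup>2))"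
    unfolding toeplitz_det_3 sums low_coeffs
    by (simp add: field_simps power2_eq_square)
  show ?thesis
    unfolding eq using norm_triangle_mono[OF three bound] by simp
qed

lemma toeplitz_det_3_2_le: "cmod (toeplitz_det f 3 2) \<le> 7 / 3"
proof -
  let ?t = "(cmod (e 1))\<^sup>2"
  \<comment> \<open>Replacing e_1 e_3 by \<open>?B\<close> + e_1^2 e_2 turns the factor a_2^2 - 2
    a_3^2 + a_2 a_4 into \<open>(e 1)\<^sup>2 - e 2 * ?A + ?B / 2\<close>; here 7/18 = 8/9 -
    1/2.\<close>
  let ?A = "7 / 18 * (e 1)\<^sup>2 + 8 / 9 * (e 2 - (e 1)\<^sup>2)"
  let ?B = "e 1 * (e 3 - e 1 * e 2)"
  have "cmod ?A \<le> 7 / 18 * ?t + 8 / 9 * cmod (e 2 - (e 1)\<^sup>2)"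
    by (rule order.trans[OF norm_triangle_ineq])
      (simp add: norm_mult norm_power norm_divide del: right_diff_distrib_numeral)
  also have "\<dots> \<le> 7 / 18 * ?t + 8 / 9 * (1 - ?t)"
    using e_2_diff_le by simp
  finally have "cmod (e 2) * cmod ?A \<le> 1 * (7 / 18 * ?t + 8 / 9 * (1 - ?t))"
    using e_le[of 2] by (intro mult_mono) auto
  then have A: "cmod (e 2 * ?A) \<le> 7 / 18 * ?t + 8 / 9 * (1 - ?t)"
    by (simp add: norm_mult)
  have B: "cmod (?B / 2) \<le> (?t / 3 + 3 / 4 * (1 - ?t)) / 2"
    using Caratheodory_coeff_3_le[OF deriv_class_R] unfolding e_def by (simp add: norm_divide)
  have "cmod ((e 1)\<^sup>2 - e 2 * ?A + ?B / 2) \<le> ?t + cmod (e 2 * ?A) + cmod (?B / 2)"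
    using norm_triangle_ineq[of "(e 1)\<^sup>2 - e 2 * ?A" "?B / 2"]
      norm_triangle_ineq4[of "(e 1)\<^sup>2" "e 2 * ?A"]
    unfolding norm_power by linarith
  also have "\<dots> \<le> 14 / 9"
  proof -
    \<comment> \<open>The sum of the three bounds is affine in \<open>t\<close> with slope 7/24, so
      the worst case is \<open>t = 1\<close>, with value 1 + 7/18 + 1/6.\<close>
    have "t + x + y \<le> 14 / 9"
      if "x \<le> 7 / 18 * t + 8 / 9 * (1 - t)" "y \<le> (t / 3 + 3 / 4 * (1 - t)) / 2" "t \<le> 1"
      for t x y :: real
      using that by (simp add: field_simps)
    then show ?thesis
      using A B e_1_sq_le by blast
  qed
  finally have C: "cmod ((e 1)\<^sup>2 - e 2 * ?A + ?B / 2) \<le> 14 / 9" .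
  have D: "cmod (e 1 - e 3 / 2) \<le> 3 / 2"
    using norm_triangle_ineq4[of "e 1" "e 3 / 2"] e_le[of 1] e_le[of 3] by (simp add: norm_divide)
  have sums: "2 + 1 = (3::nat)" "2 + 2 = (4::nat)"
    by simp_all
  have "toeplitz_det f 3 2 = (e 1 - e 3 / 2) * ((e 1)\<^sup>2 - e 2 * ?A + ?B / 2)"
    unfolding toeplitz_det_3 sums low_coeffs
    by (simp add: field_simps power2_eq_square power3_eq_cube)
  then have "cmod (toeplitz_det f 3 2) \<le> 3 / 2 * (14 / 9)"
    using C D by (simp only: norm_mult) (intro mult_mono, auto)
  then show ?thesis
    by simp
qed

end

section \<open>The extremal function and sharpness\<close>

definition extremal :: "complex \<Rightarrow> complex"
  where "extremal z = 2 * \<i> * Ln (1 - \<i> * z) - z"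

lemma Re_one_minus_i_mult_pos: "z \<in> \<D> \<Longrightarrow> 0 < Re (1 - \<i> * z)"
  using complex_Re_le_cmod[of "\<i> * z"] by (simp add: norm_mult)

lemma one_minus_i_mult_nonzero: "z \<in> \<D> \<Longrightarrow> 1 - \<i> * z \<noteq> 0"
  by (metis Re_one_minus_i_mult_pos less_irrefl zero_complex.sel(1))

lemma extremal_has_field_derivative:
  assumes "z \<in> \<D>"
  shows "(extremal has_field_derivative (2 / (1 - \<i> * z) - 1)) (at z)"
proof -
  \<comment> \<open>The argument of \<open>Ln\<close> stays in the right half-plane, away from the
    branch cut.\<close>
  have "1 - \<i> * z \<notin> \<real>\<^sub>\<le>\<^sub>0"
    using Re_one_minus_i_mult_pos[OF assms] by (metis complex_nonpos_Reals_iff not_le)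
  then show ?thesis
    unfolding extremal_def[abs_def] by (auto intro!: derivative_eq_intros simp: divide_simps algebra_simps)
qed

lemma has_field_derivative_inverse_power_one_minus_i_mult:
  assumes "z \<in> \<D>"
  shows "((\<lambda>x. c / (1 - \<i> * x) ^ Suc m) has_field_derivative
    c * of_nat (Suc m) * \<i> / (1 - \<i> * z) ^ Suc (Suc m)) (at z)"
proof -
  have nz: "1 - \<i> * z \<noteq> 0"
    using assms by (rule one_minus_i_mult_nonzero)
  have lin: "((\<lambda>x. 1 - \<i> * x) has_field_derivative - \<i>) (at z)"
    by (auto intro!: derivative_eq_intros)
  have "((\<lambda>x. c / (1 - \<i> * x) ^ Suc m) has_field_derivative
      (0 * (1 - \<i> * z) ^ Suc m - c * ((1 + of_nat m) * (- \<i> * (1 - \<i> * z) ^ m)))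
      / ((1 - \<i> * z) ^ Suc m * (1 - \<i> * z) ^ Suc m)) (at z)"
    by (rule DERIV_divide[OF DERIV_const DERIV_power_Suc[OF lin]]) (use nz in simp)
  then show ?thesis
    by (rule DERIV_cong) (use nz in \<open>simp add: divide_simps\<close>)
qed

text \<open>The induction starts at order 2 because the first derivative still carries the constant
  -1.\<close>

lemma higher_deriv_extremal:
  assumes "z \<in> \<D>"
  shows "(deriv ^^ (n + 2)) extremal z = 2 * fact (n + 1) * \<i> ^ (n + 1) / (1 - \<i> * z) ^ (n + 2)"
  using assms
proof (induction n arbitrary: z)
  case 0
  have "\<forall>\<^sub>F x in nhds z. deriv extremal x = 2 / (1 - \<i> * x) ^ Suc 0 - 1"
    by (rule eventually_mono[OF eventually_nhds_in_open[OF open_ball 0]])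
      (simp only: power_Suc0_right DERIV_imp_deriv[OF extremal_has_field_derivative])
  then have "deriv (deriv extremal) z = deriv (\<lambda>x. 2 / (1 - \<i> * x) ^ Suc 0 - 1) z"
    by (rule deriv_cong_ev) simp
  also have "\<dots> = 2 * of_nat (Suc 0) * \<i> / (1 - \<i> * z) ^ Suc (Suc 0) - 0"
    using 0 by (intro DERIV_imp_deriv DERIV_diff DERIV_const
        has_field_derivative_inverse_power_one_minus_i_mult)
  finally show ?case
    by (simp add: numeral_2_eq_2)
next
  case (Suc n)
  let ?c = "2 * fact (n + 1) * \<i> ^ (n + 1)"
  have "\<forall>\<^sub>F x in nhds z. (deriv ^^ (n + 2)) extremal x = ?c / (1 - \<i> * x) ^ Suc (n + 1)"
    by (rule eventually_mono[OF eventually_nhds_in_open[OF open_ball Suc.prems]])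
      (simp only: Suc.IH, simp)
  then have "deriv ((deriv ^^ (n + 2)) extremal) z = deriv (\<lambda>x. ?c / (1 - \<i> * x) ^ Suc (n + 1)) z"
    by (rule deriv_cong_ev) simp
  also have "\<dots> = ?c * of_nat (Suc (n + 1)) * \<i> / (1 - \<i> * z) ^ Suc (Suc (n + 1))"
    using Suc.prems
    by (intro DERIV_imp_deriv has_field_derivative_inverse_power_one_minus_i_mult)
  finally show ?case
    by (simp add: algebra_simps)
qed

text \<open>The moduli attain the coefficient bound 2/n, and the powers of i give the squares of
  consecutive coefficients opposite signs.\<close>

lemma taylor_coeff_extremal: "2 \<le> n \<Longrightarrow> taylor_coeff extremal n = 2 * \<i> ^ (n - 1) / of_nat n"
proof -
  assume "2 \<le> n"
  then obtain k where k: "n = k + 2"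
    by (metis add.commute le_Suc_ex)
  show ?thesis
    unfolding taylor_coeff_def k using fact_Suc[of "Suc k", where 'a = complex]
    by (subst higher_deriv_extremal) (simp_all add: divide_simps del: fact_Suc)
qed

lemma extremal_in_class_R: "extremal \<in> class_R"
proof -
  have d: "deriv extremal z = 2 / (1 - \<i> * z) - 1" if "z \<in> \<D>" for z
    using extremal_has_field_derivative[OF that] by (rule DERIV_imp_deriv)
  have "extremal holomorphic_on \<D>"
    unfolding holomorphic_on_open[OF open_ball] using extremal_has_field_derivative by blast
  then have "extremal analytic_on \<D>"
    by (simp add: analytic_on_open)
  moreover have "0 < Re (deriv extremal z)" if "z \<in> \<D>" for z
  proof -
    let ?v = "1 - \<i> * z"
    have pos: "0 < (cmod ?v)\<^sup>2"
      using one_minus_i_mult_nonzero[OF that] by simp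
    have "(cmod z)\<^sup>2 < 1"
      using that by (simp add: power_less_one_iff abs_square_less_1)
    \<comment> \<open>As |\<open>?v\<close> - 1| = |z|, the difference of the two sides is |z|^2 -
      1. The inequality says that 2 / \<open>?v\<close> has real part above 1.\<close>
    then have "(cmod ?v)\<^sup>2 < 2 * Re ?v"
      by (simp add: cmod_power2 power2_sum)
    moreover have "Re (2 / ?v) = 2 * Re ?v / (cmod ?v)\<^sup>2"
      by (simp add: Re_divide cmod_power2)
    ultimately show ?thesis
      using pos d[OF that] by simp
  qed
  ultimately show ?thesis
    using d[of 0] by (simp add: class_R_def class_A_def taylor_coeff_def extremal_def)
qed

lemma toeplitz_det_2_extremal:
  assumes "2 \<le> n"
  shows "cmod (toeplitz_det extremal 2 n) = 4 / real n ^ 2 + 4 / (real n + 1) ^ 2"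
proof -
  obtain k where k: "n = Suc k"
    using assms by (cases n) auto
  have sq: "(\<i> ^ j)\<^sup>2 = (- 1) ^ j" for j
    by (simp add: power2_eq_square flip: power_mult_distrib)
  have "toeplitz_det extremal 2 n = (-1) ^ k * of_real (4 / real n ^ 2 + 4 / (real n + 1) ^ 2)"
    unfolding toeplitz_det_2 using assms
    by (simp add: taylor_coeff_extremal k power_divide power_mult_distrib sq algebra_simps
        del: power_Suc) simp
  then show ?thesis
    by (simp add: norm_mult norm_power del: of_real_add)
qed

lemma toeplitz_det_3_1_extremal: "cmod (toeplitz_det extremal 3 1) = 35 / 9"
proof -
  have "taylor_coeff extremal 1 = 1"
    using extremal_in_class_R by (simp add: class_R_def class_A_def)
  \<comment> \<open>With a_2 = i and a_3 = -2/3, the two terms of the factorised determinant are 3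
    and 8/9, both positive.\<close>
  then have "toeplitz_det extremal 3 1 = of_real (35 / 9)"
    unfolding toeplitz_det_3
    by (simp add: taylor_coeff_extremal power2_eq_square field_simps)
  then show ?thesis
    by (simp only: norm_of_real)
qed

theorem theorem2p5:
  "(\<forall>f\<in>class_R.
      (\<forall>n\<ge>2. cmod (toeplitz_det f 2 n) \<le> 4 / real n ^ 2 + 4 / (real n + 1) ^ 2) \<and>
      cmod (toeplitz_det f 3 1) \<le> 35 / 9 \<and>
      cmod (toeplitz_det f 3 2) \<le> 7 / 3) \<and>
   (\<forall>n\<ge>2. \<exists>f\<in>class_R.
      cmod (toeplitz_det f 2 n) = 4 / real n ^ 2 + 4 / (real n + 1) ^ 2) \<and>
   (\<exists>f\<in>class_R. cmod (toeplitz_det f 3 1) = 35 / 9)"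
  by (intro conjI ballI allI impI bexI[of _ extremal] toeplitz_det_2_le toeplitz_det_3_1_le
      toeplitz_det_3_2_le extremal_in_class_R toeplitz_det_2_extremal toeplitz_det_3_1_extremal)

end
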